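(* Let $P\subset\mathbb{R}^{r-1}$ be a polytope, let $C\subset\mathbb{R}^r$ be the cone over $P$, let $n=|V(C)|$ be the number of rays of $C$ (the number of vertices of $P$), and let $d=n-\dim(C)$ be the degree of the adjoint polynomial $\mathrm{adj}_C$. Then $\mathrm{adj}_C$ vanishes to order at least $d-n+|S|$ on every flat $S$ of size $|S|\geq n-d+1$ of the hyperplane arrangement given by the linear forms $\ell_v$, $v\in V(C)$ (the homogenized facet hyperplanes of the dual polytope $P^\vee$).
   Context: The cone over $P$ is the cone $C\subset\mathbb{R}^r$ generated by $P$ placed at height 1, i.e. by the vectors $(1,p)$ with $p\in P$; $V(C)$ is the set of (vectors generating the) rays of $C$, which correspond to the vertices of $P$. For $v\in V(C)$ set $\ell_v(x)=v\cdot x\in\mathbb{R}[x_1,\ldots,x_r]$, where $\cdot$ is the scalar product. The hyperplanes $\ell_v=0$ are the facet hyperplanes of the dual cone $C^\vee$. Adjoint polynomial: let $T$ be a triangulation of $C$ into simplicial cones whose rays are among $V(C)$. For each simplicial cone $S\in T$ (of dimension $\dim C$) let $V(S)\subset V(C)$ be its set of rays and $a_S$ the volume of the parallelepiped whose edges are the vectors in $V(S)$. Then $$\mathrm{adj}_C(x)=\sum_{S\in T}\Big(a_S\prod_{v\in V(C)\setminus V(S)}\ell_v(x)\Big).$$ It is known that this is independent of the choice of triangulation $T$, and that $\mathrm{adj}_C$ is homogeneous of degree $|V(C)|-\dim(C)$. Flats: a flat of the arrangement $(\ell_v)_{v\in V(C)}$ is a subset $S\subset V(C)$ containing every $v\in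 V(C)$ for which $\ell_v$ lies in the linear span of $\{\ell_w:w\in S\}$; $|S|$ is its cardinality. A polynomial vanishes to order at least $k$ on $S$ if it lies in $(I_S)^k$, where $I_S=\langle\ell_v:v\in S\rangle$. *)

theory Defs
  imports "HOL-Analysis.Analysis" "HOL-Library.Poly_Mapping"
begin

section \<open>Cones over polytopes, their rays and triangulations\<close>

definition homogenize :: "real ^ 'm \<Rightarrow> real ^ ('m::finite option)" where
  "homogenize p = (\<chi> i. case i of None \<Rightarrow> 1 | Some j \<Rightarrow> p $ j)"

definition cone_over :: "(real ^ 'm) set \<Rightarrow> (real ^ ('m::finite option)) set" where
  "cone_over P = convex_cone hull (homogenize ` P)"

definition rays :: "'a::real_vector set \<Rightarrow> 'a set set" where
  "rays C = {R. R face_of C \<and> (\<exists>v. v \<noteq> 0 \<and> R = conic hull {v})}"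

text \<open>A choice of exactly one generating vector for every ray of the cone.\<close>

definition ray_generators :: "'a::real_vector set \<Rightarrow> 'a set \<Rightarrow> bool" where
  "ray_generators C V \<longleftrightarrow> bij_betw (\<lambda>v. conic hull {v}) V (rays C)"

definition generators_in :: "'a::real_vector set \<Rightarrow> 'a set \<Rightarrow> 'a set" where
  "generators_in V S = {v \<in> V. conic hull {v} \<in> rays S}"

text \<open>Lower-dimensional members are permitted (so a triangulation may or may not be listed together
  with the faces of its maximal cones); only the cones of full dimension enter the adjoint.\<close>

definition cone_triangulation :: "'a::real_vector set \<Rightarrow> 'a set \<Rightarrow> 'a set set \<Rightarrow> bool" where
  "cone_triangulation C V T \<longleftrightarrow>
     finite T \<and> \<Union>T = C \<and>
     (\<forall>S\<in>T. \<exists>W\<subseteq>V. independent W \<and> S = convex_cone hull W) \<and>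
     (\<forall>S\<in>T. \<forall>S'\<in>T. (S \<inter> S') face_of S \<and> (S \<inter> S') face_of S')"

section \<open>Volume of parallelepipeds\<close>

definition parallelepiped :: "'a::real_vector set \<Rightarrow> 'a set" where
  "parallelepiped W = {\<Sum>v\<in>W. c v *\<^sub>R v | c. \<forall>v\<in>W. 0 \<le> c v \<and> c v \<le> 1}"

text \<open>The \<open>k\<close>-dimensional volume of a subset of a \<open>k\<close>-dimensional linear subspace that it spans:
  the Lebesgue measure of its product with a unit cube of the orthogonal complement. When the set
  spans the whole space this is its Lebesgue measure.\<close>

definition rel_volume :: "'a::euclidean_space set \<Rightarrow> real" where
  "rel_volume A =
     (let B = (SOME B. pairwise orthogonal B \<and> (\<forall>b\<in>B. norm b = 1) \<and> span B = A\<^sup>\<bottom>)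
      in measure lebesgue {a + b | a b. a \<in> A \<and> b \<in> parallelepiped B})"

section \<open>Polynomials, linear forms and the adjoint\<close>

type_synonym 'n rpoly = "('n \<Rightarrow>\<^sub>0 nat) \<Rightarrow>\<^sub>0 real"

definition const_poly :: "real \<Rightarrow> 'n rpoly" where
  "const_poly c = Poly_Mapping.single 0 c"

definition var_poly :: "'n \<Rightarrow> 'n rpoly" where
  "var_poly i = Poly_Mapping.single (Poly_Mapping.single i 1) 1"

definition linear_form :: "real ^ 'n \<Rightarrow> ('n::finite) rpoly" where
  "linear_form v = (\<Sum>i\<in>UNIV. const_poly (v $ i) * var_poly i)"

definition adjoint_poly ::
    "(real ^ 'n) set \<Rightarrow> (real ^ 'n) set \<Rightarrow> (real ^ 'n) set set \<Rightarrow> ('n::finite) rpoly" where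
  "adjoint_poly C V T =
     (\<Sum>S | S \<in> T \<and> dim S = dim C.
        const_poly (rel_volume (parallelepiped (generators_in V S))) *
        (\<Prod>v \<in> V - generators_in V S. linear_form v))"

section \<open>Flats and order of vanishing\<close>

definition linear_span_poly :: "'n rpoly set \<Rightarrow> 'n rpoly set" where
  "linear_span_poly = module.span (\<lambda>c p. const_poly c * p)"

definition is_flat :: "(real ^ 'n) set \<Rightarrow> (real ^ ('n::finite)) set \<Rightarrow> bool" where
  "is_flat V S \<longleftrightarrow> S \<subseteq> V \<and>
     (\<forall>v\<in>V. linear_form v \<in> linear_span_poly (linear_form ` S) \<longrightarrow> v \<in> S)"

definition ideal_gen :: "'a::comm_ring_1 set \<Rightarrow> 'a set" where
  "ideal_gen = module.span (*)"

primrec ideal_power :: "'a::comm_ring_1 set \<Rightarrow> nat \<Rightarrow> 'a set" where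
  "ideal_power I 0 = UNIV"
| "ideal_power I (Suc k) = ideal_gen {a * b | a b. a \<in> I \<and> b \<in> ideal_power I k}"

definition vanishes_to_order :: "nat \<Rightarrow> (real ^ 'n) set \<Rightarrow> ('n::finite) rpoly \<Rightarrow> bool" where
  "vanishes_to_order k S f \<longleftrightarrow> f \<in> ideal_power (ideal_gen (linear_form ` S)) k"

section \<open>Consistency of the definitions\<close>

lemma module_mult: "module ((*) :: 'a::comm_ring_1 \<Rightarrow> 'a \<Rightarrow> 'a)"
  by unfold_locales (simp_all add: algebra_simps)

lemma module_const_poly: "module (\<lambda>c (p :: 'n rpoly). const_poly c * p)"
  by unfold_locales
    (simp_all add: const_poly_def algebra_simps single_add mult_single flip: mult.assoc)

lemma rel_volume_full:
  fixes A :: "'a::euclidean_space set"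
  assumes "span A = UNIV"
  shows "rel_volume A = measure lebesgue A"
proof -
  have perp: "A\<^sup>\<bottom> = {0}"
  proof -
    have "x = 0" if "\<forall>y\<in>A. orthogonal y x" for x
    proof -
      have "orthogonal x x"
        using orthogonal_to_span[of x A x] that assms by (auto simp: orthogonal_commute)
      thus ?thesis by (simp add: orthogonal_self)
    qed
    thus ?thesis by (auto simp: orthogonal_comp_def orthogonal_def)
  qed
  have eq: "pairwise orthogonal B \<and> (\<forall>b\<in>B. norm b = 1) \<and> span B = A\<^sup>\<bottom> \<longleftrightarrow> B = {}" for B
    using perp span_superset[of B] by fastforce
  show ?thesis
    unfolding rel_volume_def eq by (simp add: parallelepiped_def)
qed

lemma convex_cone_hull_finite:
  assumes "finite W"
  shows "convex_cone hull W = {\<Sum>v\<in>W. c v *\<^sub>R v | c. \<forall>v\<in>W. (0::real) \<le> c v}" (is "_ = ?R")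
proof (rule hull_unique)
  show "W \<subseteq> ?R"
  proof
    fix w assume "w \<in> W"
    have "(\<Sum>v\<in>W. (if v = w then 1 else 0) *\<^sub>R v) = (\<Sum>v\<in>W. if v = w then w else 0)"
      by (rule sum.cong) auto
    hence "w = (\<Sum>v\<in>W. (if v = w then 1 else 0) *\<^sub>R v)"
      using \<open>w \<in> W\<close> assms by simp
    thus "w \<in> ?R" by (intro CollectI exI[of _ "\<lambda>v. if v = w then 1 else 0"]) auto
  qed
  show "convex_cone ?R"
    unfolding convex_cone_iff
  proof (intro conjI ballI allI impI)
    have "0 = (\<Sum>v\<in>W. (\<lambda>_. 0::real) v *\<^sub>R v)" by simp
    thus "0 \<in> ?R" by (intro CollectI exI[of _ "\<lambda>_. 0"]) simp
  next
    fix x y assume "x \<in> ?R" "y \<in> ?R"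
    then obtain c d where "x = (\<Sum>v\<in>W. c v *\<^sub>R v)" "\<forall>v\<in>W. 0 \<le> c v"
      "y = (\<Sum>v\<in>W. d v *\<^sub>R v)" "\<forall>v\<in>W. 0 \<le> d v" by blast
    thus "x + y \<in> ?R"
      by (intro CollectI exI[of _ "\<lambda>v. c v + d v"]) (auto simp: sum.distrib scaleR_add_left)
  next
    fix x and a :: real assume "x \<in> ?R" "0 \<le> a"
    then obtain c where "x = (\<Sum>v\<in>W. c v *\<^sub>R v)" "\<forall>v\<in>W. 0 \<le> c v" by blast
    thus "a *\<^sub>R x \<in> ?R" using \<open>0 \<le> a\<close>
      by (intro CollectI exI[of _ "\<lambda>v. a * c v"]) (auto simp: scaleR_sum_right)
  qed
  fix D assume D: "W \<subseteq> D" "convex_cone D"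
  show "?R \<subseteq> D"
  proof clarify
    fix c :: "'a \<Rightarrow> real" assume c: "\<forall>v\<in>W. 0 \<le> c v"
    have "U \<subseteq> W \<Longrightarrow> (\<Sum>v\<in>U. c v *\<^sub>R v) \<in> D" if "finite U" for U
      using that
    proof induction
      case empty
      thus ?case by (simp add: convex_cone_contains_0 D)
    next
      case (insert x F)
      thus ?case using c D by (auto intro!: convex_cone_add convex_cone_scaleR)
    qed
    thus "(\<Sum>v\<in>W. c v *\<^sub>R v) \<in> D" using assms by blast
  qed
qed

lemma conic_hull_singleton: "conic hull {v} = {t *\<^sub>R v | t. 0 \<le> t}"
  by (auto simp: conic_hull_explicit)

lemma generators_in_simplicial:
  fixes C :: "'a::euclidean_space set"
  assumes V: "ray_generators C V" and W: "W \<subseteq> V" "independent W"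
  shows "generators_in V (convex_cone hull W) = W"
proof -
  have fin: "finite W" using W(2) by (rule independent_imp_finite)
  note hull = convex_cone_hull_finite[OF fin]
  have inj: "inj_on (\<lambda>v. conic hull {v}) V"
    using V by (auto simp: ray_generators_def bij_betw_def)
  show ?thesis
  proof (intro equalityI subsetI)
    fix w assume w: "w \<in> W"
    have "w \<noteq> 0" using w W(2) dependent_zero by blast
    have "conic hull {w} face_of convex_cone hull W"
      unfolding face_of_def
    proof (intro conjI ballI impI)
      show sub: "conic hull {w} \<subseteq> convex_cone hull W"
        using w by (auto simp: conic_hull_singleton hull_inc intro: convex_cone_hull_mul)
      show "convex (conic hull {w})"
        by (simp add: convex_conic_hull)
      fix a b x assume "a \<in> convex_cone hull W" "b \<in> convex_cone hull W"
        and x: "x \<in> conic hull {w}" "x \<in> open_segment a b"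
      then obtain c d where c: "a = (\<Sum>v\<in>W. c v *\<^sub>R v)" "\<forall>v\<in>W. 0 \<le> c v"
        and d: "b = (\<Sum>v\<in>W. d v *\<^sub>R v)" "\<forall>v\<in>W. 0 \<le> d v" unfolding hull by blast
      obtain t where t: "x = t *\<^sub>R w" using x by (auto simp: conic_hull_singleton)
      obtain u where u: "0 < u" "u < 1" "x = (1 - u) *\<^sub>R a + u *\<^sub>R b"
        using x by (auto simp: in_segment)
      define e where "e v = (1 - u) * c v + u * d v - (if v = w then t else 0)" for v
      have "(\<Sum>v\<in>W. e v *\<^sub>R v) = (1 - u) *\<^sub>R a + u *\<^sub>R b - (\<Sum>v\<in>W. if v = w then t *\<^sub>R w else 0)"
        unfolding c d e_def scaleR_sum_right sum_subtractf[symmetric] sum.distrib[symmetric]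
        by (intro sum.cong) (auto simp: algebra_simps)
      also have "\<dots> = 0" using u t w fin by simp
      finally have e0: "e v = 0" if "v \<in> W" for v
        using independentD[OF W(2) fin subset_refl] that by blast
      have "c v = 0 \<and> d v = 0" if "v \<in> W" "v \<noteq> w" for v
      proof -
        have "(1 - u) * c v + u * d v = 0" using e0[OF that(1)] that by (simp add: e_def)
        moreover have "0 \<le> (1 - u) * c v" "0 \<le> u * d v" using u c d that by auto
        ultimately have "(1 - u) * c v = 0" "u * d v = 0" by linarith+
        thus ?thesis using u by auto
      qed
      hence "a = (\<Sum>v\<in>W. if v = w then c w *\<^sub>R w else 0)" "b = (\<Sum>v\<in>W. if v = w then d w *\<^sub>R w else 0)"
        unfolding c d by (auto intro!: sum.cong)
      hence "a = c w *\<^sub>R w" "b = d w *\<^sub>R w" using w fin by auto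
      thus "a \<in> conic hull {w}" "b \<in> conic hull {w}"
        using c d w by (auto simp: conic_hull_singleton)
    qed
    thus "w \<in> generators_in V (convex_cone hull W)"
      using w W \<open>w \<noteq> 0\<close> by (auto simp: generators_in_def rays_def)
  next
    fix v assume "v \<in> generators_in V (convex_cone hull W)"
    hence vV: "v \<in> V" and F: "conic hull {v} face_of convex_cone hull W"
      and "\<exists>v'. v' \<noteq> 0 \<and> conic hull {v} = conic hull {v'}"
      by (auto simp: generators_in_def rays_def)
    then obtain v' where v': "v' \<noteq> 0" "conic hull {v} = conic hull {v'}" by blast
    hence "v' \<in> conic hull {v}" by (simp add: hull_inc)
    hence v0: "v \<noteq> 0" using v'(1) by (auto simp: conic_hull_singleton)
    have vin: "v \<in> conic hull {v}" by (simp add: hull_inc)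
    hence "v \<in> convex_cone hull W" using F face_of_imp_subset by blast
    then obtain c where c: "v = (\<Sum>w\<in>W. c w *\<^sub>R w)" "\<forall>w\<in>W. 0 \<le> c w" unfolding hull by blast
    have "\<exists>w\<in>W. c w \<noteq> 0"
    proof (rule ccontr)
      assume "\<not> (\<exists>w\<in>W. c w \<noteq> 0)"
      hence "(\<Sum>w\<in>W. c w *\<^sub>R w) = 0" by (intro sum.neutral) auto
      thus False using v0 c(1) by simp
    qed
    then obtain w where w: "w \<in> W" "c w \<noteq> 0" by blast
    have "c w > 0" using w c by force
    have "w \<noteq> 0" using w W(2) dependent_zero by blast
    define a where "a = (2 * c w) *\<^sub>R w"
    define b where "b = 2 *\<^sub>R (\<Sum>z\<in>W - {w}. c z *\<^sub>R z)"
    have veq: "v = (1 - 1/2) *\<^sub>R a + (1/2) *\<^sub>R b"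
      using sum.remove[OF fin w(1), of "\<lambda>z. c z *\<^sub>R z"] by (simp add: a_def b_def flip: c(1))
    have aH: "a \<in> convex_cone hull W"
      unfolding a_def using w \<open>c w > 0\<close> by (intro convex_cone_hull_mul hull_inc) auto
    have "(\<Sum>z\<in>W - {w}. c z *\<^sub>R z) \<in> convex_cone hull (W - {w})"
      using convex_cone_hull_finite[of "W - {w}"] fin c by auto
    hence "(\<Sum>z\<in>W - {w}. c z *\<^sub>R z) \<in> convex_cone hull W"
      using hull_mono[of "W - {w}" W convex_cone] by blast
    hence bH: "b \<in> convex_cone hull W"
      unfolding b_def by (intro convex_cone_hull_mul) auto
    have "a \<in> conic hull {v}"
    proof (cases "a = b")
      case True
      hence "v = a" using veq by (simp flip: scaleR_add_left)
      thus ?thesis using vin by simp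
    next
      case False
      hence "v \<in> open_segment a b" using veq by (auto simp: in_segment intro!: exI[of _ "1/2"])
      thus ?thesis using F aH bH vin by (auto simp: face_of_def)
    qed
    then obtain t where t: "a = t *\<^sub>R v" "0 \<le> t" by (auto simp: conic_hull_singleton)
    hence "t > 0" using \<open>c w > 0\<close> \<open>w \<noteq> 0\<close> a_def by (cases "t = 0") auto
    define s where "s = t / (2 * c w)"
    have "s > 0" using \<open>t > 0\<close> \<open>c w > 0\<close> by (simp add: s_def)
    have "w = (1 / (2 * c w)) *\<^sub>R a" using \<open>c w > 0\<close> by (simp add: a_def)
    hence ws: "w = s *\<^sub>R v" using t by (simp add: s_def)
    have "conic hull {w} = conic hull {v}"
    proof
      show "conic hull {w} \<subseteq> conic hull {v}"
        unfolding conic_hull_singleton ws using \<open>s > 0\<close> by fastforce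
      show "conic hull {v} \<subseteq> conic hull {w}"
      proof
        fix x assume "x \<in> conic hull {v}"
        then obtain r where "0 \<le> r" "x = r *\<^sub>R v" by (auto simp: conic_hull_singleton)
        hence "x = (r / s) *\<^sub>R w" "0 \<le> r / s" using ws \<open>s > 0\<close> by auto
        thus "x \<in> conic hull {w}" unfolding conic_hull_singleton by blast
      qed
    qed
    hence "v = w" using inj vV w W by (metis inj_onD subsetD)
    thus "v \<in> W" using w by simp
  qed
qed

lemma homogenize_nth [simp]: "homogenize p $ None = 1" "homogenize p $ Some j = p $ j"
  by (simp_all add: homogenize_def)

lemma homogenize_comb:
  assumes "a + b = 1"
  shows "homogenize (a *\<^sub>R p + b *\<^sub>R q) = a *\<^sub>R homogenize p + b *\<^sub>R homogenize q"
  using assms by (auto simp: vec_eq_iff homogenize_def split: option.splits)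

lemma homogenize_scaled_eq: "homogenize q = c *\<^sub>R homogenize p \<longleftrightarrow> c = 1 \<and> q = p"
proof
  assume eq: "homogenize q = c *\<^sub>R homogenize p"
  have "c = 1" using arg_cong[OF eq, of "\<lambda>x. x $ None"] by simp
  moreover have "q $ j = c * p $ j" for j
    using arg_cong[OF eq, of "\<lambda>x. x $ Some j"] by simp
  ultimately show "c = 1 \<and> q = p" by (simp add: vec_eq_iff)
qed auto

lemma cone_over_convex:
  assumes "convex P"
  shows "cone_over P = insert 0 {t *\<^sub>R homogenize p | t p. 0 \<le> t \<and> p \<in> P}" (is "_ = ?R")
  unfolding cone_over_def
proof (rule hull_unique)
  show "homogenize ` P \<subseteq> ?R"
  proof (rule image_subsetI)
    fix p assume "p \<in> P"
    moreover have "homogenize p = 1 *\<^sub>R homogenize p" by simp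
    ultimately have "homogenize p \<in> {t *\<^sub>R homogenize p |t p. 0 \<le> t \<and> p \<in> P}"
      using zero_le_one by blast
    thus "homogenize p \<in> ?R" by (rule insertI2)
  qed
  show "convex_cone ?R"
    unfolding convex_cone_iff
  proof (intro conjI ballI allI impI)
    fix x y assume x: "x \<in> ?R" and y: "y \<in> ?R"
    show "x + y \<in> ?R"
    proof (cases "x = 0 \<or> y = 0")
      case True thus ?thesis using x y by auto
    next
      case False
      then obtain s p t q where x: "x = s *\<^sub>R homogenize p" "0 \<le> s" "p \<in> P"
        and y: "y = t *\<^sub>R homogenize q" "0 \<le> t" "q \<in> P" using x y by auto
      hence pos: "s > 0" "t > 0" using False by (auto simp: less_le)
      define z where "z = (s / (s + t)) *\<^sub>R p + (t / (s + t)) *\<^sub>R q"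
      have one: "s / (s + t) + t / (s + t) = 1" using pos by (simp flip: add_divide_distrib)
      have "z \<in> P" unfolding z_def using assms x y pos one by (intro convexD) auto
      moreover have "x + y = (s + t) *\<^sub>R homogenize z"
        unfolding z_def homogenize_comb[OF one] x y using pos by (simp add: scaleR_add_right)
      ultimately show ?thesis using pos by (auto intro!: exI[of _ "s + t"] exI[of _ z])
    qed
  next
    fix x and c :: real assume "x \<in> ?R" "0 \<le> c"
    then consider "x = 0" | s p where "x = s *\<^sub>R homogenize p" "0 \<le> s" "p \<in> P" by auto
    thus "c *\<^sub>R x \<in> ?R"
    proof cases
      case 2
      hence "c *\<^sub>R x = (c * s) *\<^sub>R homogenize p" "0 \<le> c * s" using \<open>0 \<le> c\<close> by auto
      thus ?thesis using 2(3) by blast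
    qed simp
  qed simp
  fix D assume "homogenize ` P \<subseteq> D" "convex_cone D"
  thus "?R \<subseteq> D" by (auto intro: convex_cone_contains_0 convex_cone_scaleR)
qed

lemma ray_generators_vertices:
  fixes P :: "(real ^ 'm::finite) set"
  assumes "convex P"
  shows "ray_generators (cone_over P) (homogenize ` {p. p extreme_point_of P})"
  unfolding ray_generators_def bij_betw_def
proof
  note C = cone_over_convex[OF assms]
  have hne: "homogenize p \<noteq> 0" for p :: "real ^ 'm"
    by (metis homogenize_nth(1) zero_index zero_neq_one)
  show "inj_on (\<lambda>v. conic hull {v}) (homogenize ` {p. p extreme_point_of P})"
  proof (rule inj_onI, clarify)
    fix p q :: "real ^ 'm" assume "conic hull {homogenize p} = conic hull {homogenize q}"
    hence "homogenize p \<in> conic hull {homogenize q}" by (metis hull_inc singletonI)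
    thus "homogenize p = homogenize q"
      by (auto simp: conic_hull_singleton homogenize_scaled_eq)
  qed
  show "(\<lambda>v. conic hull {v}) ` homogenize ` {p. p extreme_point_of P} = rays (cone_over P)"
  proof (intro equalityI subsetI)
    fix R assume "R \<in> (\<lambda>v. conic hull {v}) ` homogenize ` {p. p extreme_point_of P}"
    then obtain p where p: "p extreme_point_of P" and R: "R = conic hull {homogenize p}" by auto
    have pP: "p \<in> P" using p by (simp add: extreme_point_of_def)
    have "R face_of cone_over P"
      unfolding face_of_def
    proof (intro conjI ballI impI)
      show "R \<subseteq> cone_over P" using pP by (auto simp: R C conic_hull_singleton)
      show "convex R" by (simp add: R convex_conic_hull)
      fix a b x assume a: "a \<in> cone_over P" and b: "b \<in> cone_over P" and x: "x \<in> R"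
        and seg: "x \<in> open_segment a b"
      obtain s p1 where s: "a = s *\<^sub>R homogenize p1" "0 \<le> s" "p1 \<in> P"
        using a pP unfolding C by (auto intro: that[of 0 p])
      obtain t p2 where t: "b = t *\<^sub>R homogenize p2" "0 \<le> t" "p2 \<in> P"
        using b pP unfolding C by (auto intro: that[of 0 p])
      obtain r where r: "x = r *\<^sub>R homogenize p" "0 \<le> r" using x by (auto simp: R conic_hull_singleton)
      obtain u where u: "0 < u" "u < 1" "x = (1 - u) *\<^sub>R a + u *\<^sub>R b" and ab: "a \<noteq> b"
        using seg by (auto simp: in_segment)
      have rs: "r = (1 - u) * s + u * t"
        using arg_cong[OF u(3), of "\<lambda>x. x $ None"] by (simp add: s t r)
      have coord: "r * p $ j = (1 - u) * s * p1 $ j + u * t * p2 $ j" for j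
        using arg_cong[OF u(3), of "\<lambda>x. x $ Some j"] by (simp add: s t r)
      have "(s = 0 \<or> p1 = p) \<and> (t = 0 \<or> p2 = p)"
      proof (cases "s = 0 \<or> t = 0")
        case True
        have "s \<noteq> 0 \<or> t \<noteq> 0" using ab s t by auto
        thus ?thesis using True coord rs u by (auto simp: vec_eq_iff)
      next
        case False
        hence pos: "s > 0" "t > 0" using s t by auto
        moreover from this have "r > 0" unfolding rs using u by (intro add_pos_pos) auto
        ultimately have pos: "s > 0" "t > 0" "r > 0" by auto
        define l where "l = u * t / r"
        have l1: "1 - l = (1 - u) * s / r"
          using pos unfolding l_def by (simp add: field_simps) (simp add: rs algebra_simps)
        hence "1 - l > 0" using pos u by simp
        moreover have "0 < l" unfolding l_def using pos u by simp
        ultimately have l: "0 < l" "l < 1" "1 - l = (1 - u) * s / r" using l1 by auto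
        have "p = (1 - l) *\<^sub>R p1 + l *\<^sub>R p2"
        proof (subst vec_eq_iff, intro allI)
          fix j
          have "((1 - l) *\<^sub>R p1 + l *\<^sub>R p2) $ j = (r * p $ j) / r"
            unfolding coord by (simp add: l(3)) (simp add: l_def add_divide_distrib)
          thus "p $ j = ((1 - l) *\<^sub>R p1 + l *\<^sub>R p2) $ j" using pos by simp
        qed
        moreover from this l have "p1 \<noteq> p2 \<Longrightarrow> p \<in> open_segment p1 p2"
          unfolding in_segment by blast
        ultimately have "p1 = p2" using p s t by (auto simp: extreme_point_of_def)
        with \<open>p = (1 - l) *\<^sub>R p1 + l *\<^sub>R p2\<close> show ?thesis by (simp flip: scaleR_add_left)
      qed
      thus "a \<in> R" "b \<in> R"
        using s t by (auto simp: R conic_hull_singleton)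
    qed
    thus "R \<in> rays (cone_over P)" using hne by (auto simp: R rays_def)
  next
    fix R assume "R \<in> rays (cone_over P)"
    then obtain v where F: "R face_of cone_over P" and v: "v \<noteq> 0" "R = conic hull {v}"
      by (auto simp: rays_def)
    have vR: "v \<in> R" by (simp add: v hull_inc)
    hence "v \<in> cone_over P" using F face_of_imp_subset by blast
    then obtain c p where c: "v = c *\<^sub>R homogenize p" "0 \<le> c" "p \<in> P"
      using v by (auto simp: C)
    have "c > 0" using v c by (auto simp: less_le)
    have Rp: "R = conic hull {homogenize p}"
    proof
      show "R \<subseteq> conic hull {homogenize p}"
        unfolding v(2) conic_hull_singleton c(1) using \<open>c > 0\<close> by fastforce
      show "conic hull {homogenize p} \<subseteq> R"
      proof
        fix x assume "x \<in> conic hull {homogenize p}"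
        then obtain r where "0 \<le> r" "x = r *\<^sub>R homogenize p" by (auto simp: conic_hull_singleton)
        hence "x = (r / c) *\<^sub>R v" "0 \<le> r / c" using c \<open>c > 0\<close> by auto
        thus "x \<in> R" unfolding v(2) conic_hull_singleton by blast
      qed
    qed
    have hC: "homogenize q \<in> cone_over P" if "q \<in> P" for q
      using that by (simp add: cone_over_def hull_inc)
    have "p extreme_point_of P"
      unfolding extreme_point_of_def
    proof (intro conjI ballI notI)
      fix a b assume ab: "a \<in> P" "b \<in> P" and seg: "p \<in> open_segment a b"
      then obtain u where u: "0 < u" "u < 1" "p = (1 - u) *\<^sub>R a + u *\<^sub>R b" "a \<noteq> b"
        by (auto simp: in_segment)
      have "homogenize p = (1 - u) *\<^sub>R homogenize a + u *\<^sub>R homogenize b"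
        unfolding u(3) by (rule homogenize_comb) simp
      moreover have "homogenize a \<noteq> homogenize b"
        using homogenize_scaled_eq[of a 1 b] u(4) by simp
      ultimately have "homogenize p \<in> open_segment (homogenize a) (homogenize b)"
        using u by (auto simp: in_segment)
      moreover have "homogenize p \<in> R" by (simp add: Rp hull_inc)
      ultimately have "homogenize a \<in> R" using F ab hC unfolding face_of_def by blast
      hence "a = p" by (auto simp: Rp conic_hull_singleton homogenize_scaled_eq)
      thus False using seg by (simp add: open_segment_def)
    qed (use c in simp)
    thus "R \<in> (\<lambda>v. conic hull {v}) ` homogenize ` {p. p extreme_point_of P}"
      using Rp by blast
  qed
qed

end

theory Submission
  imports Defs
begin

text \<open>Every summand of the adjoint vanishes to the required order: a maximal simplicial cone has
  exactly \<open>dim C\<close> rays, so at least \<open>|S| - dim C\<close> of the linear forms of a set \<open>S\<close> remain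
  in the product over the complementary rays.\<close>

text \<open>Power 0 is the whole ring and each later power is a span by definition, so a case split
  on \<open>k\<close> suffices. Closure under ring multiples and sums follows.\<close>

lemma subspace_ideal_power:
  fixes I :: "'a::comm_ring_1 set"
  shows "module.subspace (*) (ideal_power I k)"
proof -
  interpret module "(*) :: 'a \<Rightarrow> 'a \<Rightarrow> 'a" by (rule module_mult)
  show ?thesis by (cases k) (simp_all add: ideal_gen_def)
qed

lemma ideal_power_mult:
  fixes I :: "'a::comm_ring_1 set"
  assumes "x \<in> ideal_power I k"
  shows "a * x \<in> ideal_power I k"
proof -
  interpret module "(*) :: 'a \<Rightarrow> 'a \<Rightarrow> 'a" by (rule module_mult)
  show ?thesis using subspace_scale[OF subspace_ideal_power assms] .
qed

lemma ideal_power_sum: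
  fixes I :: "'a::comm_ring_1 set"
  assumes "\<And>i. i \<in> A \<Longrightarrow> f i \<in> ideal_power I k"
  shows "(\<Sum>i\<in>A. f i) \<in> ideal_power I k"
proof -
  interpret module "(*) :: 'a \<Rightarrow> 'a \<Rightarrow> 'a" by (rule module_mult)
  show ?thesis using subspace_sum[OF subspace_ideal_power] assms by blast
qed

lemma ideal_gen_superset: "X \<subseteq> ideal_gen (X :: 'a::comm_ring_1 set)"
  unfolding ideal_gen_def by (rule module.span_superset[OF module_mult])

lemma prod_in_ideal_power:
  fixes I :: "'a::comm_ring_1 set"
  assumes "finite A" "\<And>i. i \<in> A \<Longrightarrow> f i \<in> I"
  shows "(\<Prod>i\<in>A. f i) \<in> ideal_power I (card A)"
  using assms
proof (induction A rule: finite_induct)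
  case (insert x A)
  \<comment> \<open>One factor from \<open>I\<close> times an element of the previous power: a
    generator of the next power.\<close>
  hence "f x * (\<Prod>i\<in>A. f i) \<in> {a * b | a b. a \<in> I \<and> b \<in> ideal_power I (card A)}"
    by blast
  from subsetD[OF ideal_gen_superset this] show ?case using insert.hyps by simp
qed simp

text \<open>Exactly \<open>k\<close> of the factors indexed by \<open>S\<close> are set aside; their
  product lies in the \<open>k\<close>-th power, which absorbs the remaining factors as a ring
  multiple.\<close>

lemma prod_vanishes_to_order:
  assumes "finite A" "k \<le> card (A \<inter> S)"
  shows "vanishes_to_order k S (\<Prod>v\<in>A. linear_form v)"
proof -
  obtain B where B: "B \<subseteq> A \<inter> S" "card B = k" "finite B"
    using assms(2) by (rule obtain_subset_with_card_n)
  have "(\<Prod>v\<in>B. linear_form v) \<in> ideal_power (ideal_gen (linear_form ` S)) k"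
    using prod_in_ideal_power[OF B(3), of linear_form] B ideal_gen_superset[of "linear_form ` S"]
    by blast
  moreover have "(\<Prod>v\<in>A. linear_form v) = (\<Prod>v\<in>A - B. linear_form v) * (\<Prod>v\<in>B. linear_form v)"
    using B assms(1) by (intro prod.subset_diff) auto
  ultimately show ?thesis
    by (simp add: vanishes_to_order_def ideal_power_mult)
qed

text \<open>The hull lies between \<open>W\<close> and its linear span.\<close>

lemma dim_convex_cone_hull: "dim (convex_cone hull W) = dim (W :: 'a::euclidean_space set)"
proof (rule antisym)
  have "convex_cone hull W \<subseteq> span W"
    by (intro hull_minimal span_superset subspace_imp_convex_cone subspace_span)
  thus "dim (convex_cone hull W) \<le> dim W"
    by (metis dim_span dim_subset)
qed (simp add: dim_subset hull_subset)

text \<open>\<open>V\<close> is an arbitrary choice of generators, so finiteness passes through the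
  set of rays, which is also in bijection with the homogenized vertices of \<open>P\<close>.\<close>

lemma finite_ray_generators_polytope:
  fixes P :: "(real ^ 'm::finite) set"
  assumes "polytope P" "ray_generators (cone_over P) V"
  shows "finite V"
proof -
  have "finite {p. p extreme_point_of P}"
    using assms(1) by (simp add: finite_polyhedron_extreme_points polytope_imp_polyhedron)
  hence "finite (rays (cone_over P))"
    using ray_generators_vertices[OF polytope_imp_convex[OF assms(1)]]
    by (metis bij_betw_finite finite_imageI ray_generators_def)
  thus ?thesis using assms(2) bij_betw_finite unfolding ray_generators_def by blast
qed

theorem proposition4p2:
  fixes P :: "(real ^ 'm::finite) set"
    and C :: "(real ^ ('m option)) set"
    and V :: "(real ^ ('m option)) set"
    and T :: "(real ^ ('m option)) set set"
    and n d :: nat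
  assumes "polytope P"
    and "C = cone_over P"
    and "ray_generators C V"
    and "cone_triangulation C V T"
    and "n = card V"
    and "d = n - dim C"
  shows "\<forall>S. is_flat V S \<and> card S \<ge> n - d + 1 \<longrightarrow>
           vanishes_to_order (d + card S - n) S (adjoint_poly C V T)"
proof (intro allI impI)
  fix S assume "is_flat V S \<and> card S \<ge> n - d + 1"
  hence SV: "S \<subseteq> V" by (simp add: is_flat_def)
  have fin: "finite V" using finite_ray_generators_polytope assms by blast
  have "vanishes_to_order (d + card S - n) S (\<Prod>v \<in> V - generators_in V D. linear_form v)"
    if D: "D \<in> T" "dim D = dim C" for D
  proof -
    obtain W where W: "W \<subseteq> V" "independent W" "D = convex_cone hull W"
      using assms(4) D(1) unfolding cone_triangulation_def by blast
    have gen: "generators_in V D = W"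
      using generators_in_simplicial assms(3) W by blast
    have "card W = dim C"
      using D(2) W by (simp add: dim_convex_cone_hull dim_eq_card_independent)
    \<comment> \<open>This gives \<open>dim C\<close> \<le> \<open>n\<close>, so the truncated
      difference defining \<open>d\<close> is exact.\<close>
    moreover have "card W \<le> n" using W fin assms(5) by (simp add: card_mono)
    ultimately have "d + card S - n = card S - card W" using assms(6) by simp
    \<comment> \<open>\<open>W\<close> need not lie inside \<open>S\<close>, hence only an
      inequality.\<close>
    also have "\<dots> \<le> card (S - W)"
      using W(1) fin by (intro diff_card_le_card_Diff) (rule finite_subset)
    also have "S - W = (V - W) \<inter> S" using SV by blast
    finally show ?thesis unfolding gen using fin by (intro prod_vanishes_to_order) auto
  qed
  \<comment> \<open>The volume coefficients are ring multiples, and the order is the same for all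
    summands, so the sum stays in the ideal power.\<close>
  thus "vanishes_to_order (d + card S - n) S (adjoint_poly C V T)"
    unfolding vanishes_to_order_def adjoint_poly_def
    by (intro ideal_power_sum ideal_power_mult) blast
qed

end
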